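(* Let $X_{\mathcal O}$ be the Ornithorynque origami. Fix segments $H,V$ in $X_{\mathcal O}$ with $0<\mathrm{Slope}(V)<1$ and $\mathrm{Slope}(H)<-1$. If both segments have length $|H|,|V|\geq\sqrt{288}$ then $$H\cap V\neq\emptyset.$$
   Context: **Origamis.** Let $\mathcal Q$ be a finite set and $(h,v)$ a pair of permutations of $\mathcal Q$ generating a transitive subgroup of the symmetric group. The origami $X$ defined by $(h,v)$ is the surface obtained from the squares $Q_j=\{j\}\times[0,1]^2$, $j\in\mathcal Q$, by gluing (by translation), for every $j$, the right side of $Q_j$ to the left side of $Q_{h(j)}$ and the top side of $Q_j$ to the bottom side of $Q_{v(j)}$. The map $(j,x)\mapsto [x]$ induces a covering $\rho_X:X\to\mathbb T^2=\mathbb R^2/\mathbb Z^2$, ramified only over $[0]$. The points $p_1,\dots,p_m$ of $X$ where $\rho_X$ is ramified are the conical points. **The Ornithorynque.** $X_{\mathcal O}$ is the origami with $\mathcal Q=\mathbb Z/3\mathbb Z\times\mathbb Z/2\mathbb Z\times\mathbb Z/2\mathbb Z$ and, for $i\in\mathbb Z/3\mathbb Z$, $h(i,0,0)=(i+1,1,0)$, $h(i,0,1)=(i-1,1,1)$, $h(i,1,0)=(i,0,0)$, $h(i,1,1)=(i,0,1)$; $v(i,0,0)=(i-1,0,1)$, $v(i,0,1)=(i,0,0)$, $v(i,1,0)=(i+1,1,1)$, $v(i,1,1)=(i,1,0)$. It has genus $4$ and three conical points, each with angle $6\pi$. **Segments.** A (straight) segment in $X$ is a smooth path $S:(a,b)\to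 X\setminus\{p_1,\dots,p_m\}$ such that for some vector $u=(x,y)\in\mathbb R^2$ one has $\frac{d}{dt}\rho_X(S(t))=u$ for all $t\in(a,b)$. Its slope is $\mathrm{Slope}(S)=x/y\in\mathbb R\cup\{\pm\infty\}$ (so slope $0$ is vertical) and its length is $|S|=|b-a|\cdot\|u\|$ (euclidean norm). Endpoints of segments can be conical points. *)

theory Defs
  imports "HOL-Analysis.Analysis"
begin

section \<open>Quotient topology\<close>

definition quotient_topology :: "'a topology \<Rightarrow> ('a \<times> 'a) set \<Rightarrow> 'a set topology" where
  "quotient_topology T r =
     topology (\<lambda>U. U \<subseteq> topspace T // r \<and> openin T {x \<in> topspace T. r `` {x} \<in> U})"

lemma openin_quotient_topology:
  "openin (quotient_topology T r) U \<longleftrightarrow>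
     U \<subseteq> topspace T // r \<and> openin T {x \<in> topspace T. r `` {x} \<in> U}"
proof -
  have "istopology (\<lambda>U. U \<subseteq> topspace T // r \<and> openin T {x \<in> topspace T. r `` {x} \<in> U})"
    unfolding istopology_def
  proof (intro conjI allI impI; (elim conjE)?)
    fix S U
    assume "S \<subseteq> topspace T // r" then show "S \<inter> U \<subseteq> topspace T // r" by blast
    assume "openin T {x \<in> topspace T. r `` {x} \<in> S}" "openin T {x \<in> topspace T. r `` {x} \<in> U}"
    then have "openin T ({x \<in> topspace T. r `` {x} \<in> S} \<inter> {x \<in> topspace T. r `` {x} \<in> U})"
      by (rule openin_Int)
    moreover have "{x \<in> topspace T. r `` {x} \<in> S} \<inter> {x \<in> topspace T. r `` {x} \<in> U}
        = {x \<in> topspace T. r `` {x} \<in> S \<inter> U}" by blast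
    ultimately show "openin T {x \<in> topspace T. r `` {x} \<in> S \<inter> U}" by simp
  next
    fix K
    assume K: "\<forall>U\<in>K. U \<subseteq> topspace T // r \<and> openin T {x \<in> topspace T. r `` {x} \<in> U}"
    then show "\<Union>K \<subseteq> topspace T // r" by blast
    have "openin T (\<Union>U\<in>K. {x \<in> topspace T. r `` {x} \<in> U})" using K by blast
    moreover have "(\<Union>U\<in>K. {x \<in> topspace T. r `` {x} \<in> U})
        = {x \<in> topspace T. r `` {x} \<in> \<Union>K}" by blast
    ultimately show "openin T {x \<in> topspace T. r `` {x} \<in> \<Union>K}" by simp
  qed
  then show ?thesis
    by (simp add: quotient_topology_def topology_inverse')
qed

lemma topspace_quotient_topology: "topspace (quotient_topology T r) = topspace T // r"
proof -
  have "{x \<in> topspace T. r `` {x} \<in> topspace T // r} = topspace T"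
    by (auto intro: quotientI)
  then have "openin (quotient_topology T r) (topspace T // r)"
    by (simp add: openin_quotient_topology)
  then show ?thesis
    by (metis openin_quotient_topology openin_subset openin_topspace subset_antisym)
qed


section \<open>The torus\<close>

definition torus_rel :: "((real \<times> real) \<times> (real \<times> real)) set" where
  "torus_rel = {(p, q). \<exists>m n :: int. q = p + (of_int m, of_int n)}"

abbreviation torus_proj :: "real \<times> real \<Rightarrow> (real \<times> real) set" where
  "torus_proj p \<equiv> torus_rel `` {p}"

definition torus :: "(real \<times> real) set topology" where
  "torus = quotient_topology euclidean torus_rel"

(* d/dt gamma = u at t: near t, gamma lifts to a path in the plane with derivative u at t. *)
definition torus_has_derivative ::
    "(real \<Rightarrow> (real \<times> real) set) \<Rightarrow> real \<times> real \<Rightarrow> real \<Rightarrow> bool" where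
  "torus_has_derivative \<gamma> u t \<longleftrightarrow>
     (\<exists>g. (\<forall>\<^sub>F s in nhds t. \<gamma> s = torus_proj (g s)) \<and> (g has_vector_derivative u) (at t))"


section \<open>The origami defined by a pair of permutations\<close>

text \<open>
  The index set is the whole (finite) type \<open>'q\<close>. A point of the disjoint union of the closed unit
  squares is \<open>(j, x, y)\<close>; a point of the origami is a class of the equivalence relation generated by
  the gluings (so the four corners of squares are identified around each vertex).
\<close>

definition squares :: "('q::finite \<times> real \<times> real) topology" where
  "squares = prod_topology (discrete_topology UNIV) (top_of_set ({0..1} \<times> {0..1}))"

inductive gluing :: "('q::finite \<Rightarrow> 'q) \<Rightarrow> ('q \<Rightarrow> 'q) \<Rightarrow>
    'q \<times> real \<times> real \<Rightarrow> 'q \<times> real \<times> real \<Rightarrow> bool" for h v where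
  right_left: "y \<in> {0..1} \<Longrightarrow> gluing h v (j, 1, y) (h j, 0, y)"
| top_bottom: "x \<in> {0..1} \<Longrightarrow> gluing h v (j, x, 1) (v j, x, 0)"

definition origami_rel :: "('q::finite \<Rightarrow> 'q) \<Rightarrow> ('q \<Rightarrow> 'q) \<Rightarrow>
    (('q \<times> real \<times> real) \<times> ('q \<times> real \<times> real)) set" where
  "origami_rel h v = {(p, q). equivclp (gluing h v) p q}"

definition origami :: "('q::finite \<Rightarrow> 'q) \<Rightarrow> ('q \<Rightarrow> 'q) \<Rightarrow> ('q \<times> real \<times> real) set topology" where
  "origami h v = quotient_topology squares (origami_rel h v)"

definition covering :: "('q::finite \<times> real \<times> real) set \<Rightarrow> (real \<times> real) set" where
  "covering p = the_elem ((\<lambda>(j, z). torus_proj z) ` p)"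

lemma torus_proj_eqI: "(p, q) \<in> torus_rel \<Longrightarrow> torus_proj p = torus_proj q"
proof -
  assume "(p, q) \<in> torus_rel"
  then obtain m n :: int where q: "q = p + (of_int m, of_int n)"
    by (auto simp: torus_rel_def)
  show ?thesis
  proof (intro equalityI subsetI)
    fix r assume "r \<in> torus_proj p"
    then obtain a b :: int where "r = p + (of_int a, of_int b)" by (auto simp: torus_rel_def)
    then have "r = q + (of_int (a - m), of_int (b - n))" by (simp add: q prod_eq_iff)
    then show "r \<in> torus_proj q" unfolding torus_rel_def by blast
  next
    fix r assume "r \<in> torus_proj q"
    then obtain a b :: int where "r = q + (of_int a, of_int b)" by (auto simp: torus_rel_def)
    then have "r = p + (of_int (m + a), of_int (n + b))" by (simp add: q prod_eq_iff)
    then show "r \<in> torus_proj p" unfolding torus_rel_def by blast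
  qed
qed

lemma origami_rel_torus_proj:
  assumes "((j, z), (k, w)) \<in> origami_rel h v"
  shows "torus_proj z = torus_proj w"
proof -
  have step: "torus_proj (snd a) = torus_proj (snd b)" if "gluing h v a b" for a b
  proof -
    have "\<exists>m n :: int. snd b = snd a + (of_int m, of_int n)"
      using that
    proof cases
      case (right_left y j)
      then have "snd b = snd a + (of_int (-1), of_int 0)" by simp
      then show ?thesis by blast
    next
      case (top_bottom x j)
      then have "snd b = snd a + (of_int 0, of_int (-1))" by simp
      then show ?thesis by blast
    qed
    then show ?thesis by (intro torus_proj_eqI) (auto simp: torus_rel_def)
  qed
  have "torus_proj (snd a) = torus_proj (snd b)" if "equivclp (gluing h v) a b" for a b
    using that by (induction rule: equivclp_induct) (metis step)+
  from this[of "(j, z)" "(k, w)"] show ?thesis using assms by (simp add: origami_rel_def)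
qed

lemma covering_class: "covering (origami_rel h v `` {(j, z)}) = torus_proj z"
proof -
  have "(j, z) \<in> origami_rel h v `` {(j, z)}" by (simp add: origami_rel_def)
  then have "(\<lambda>(j, z). torus_proj z) ` (origami_rel h v `` {(j, z)}) = {torus_proj z}"
    using origami_rel_torus_proj by (fastforce simp del: Image_singleton_iff)
  then show ?thesis by (simp add: covering_def)
qed

(* The covering is ramified at p iff it is not a local homeomorphism at p. *)
definition conical_points :: "('q::finite \<Rightarrow> 'q) \<Rightarrow> ('q \<Rightarrow> 'q) \<Rightarrow> ('q \<times> real \<times> real) set set" where
  "conical_points h v =
     {p \<in> topspace (origami h v).
        \<not> (\<exists>U. openin (origami h v) U \<and> p \<in> U \<and> openin torus (covering ` U) \<and>
               homeomorphic_map (subtopology (origami h v) U)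
                 (subtopology torus (covering ` U)) covering)}"


section \<open>Segments\<close>

(* S is considered on the open interval (a,b) only. Away from the conical points the smooth
   structure is the one pulled back from the torus, so a continuous S whose projection has
   constant derivative u is automatically smooth. *)
definition segment :: "('q::finite \<Rightarrow> 'q) \<Rightarrow> ('q \<Rightarrow> 'q) \<Rightarrow>
    real \<Rightarrow> real \<Rightarrow> real \<times> real \<Rightarrow> (real \<Rightarrow> ('q \<times> real \<times> real) set) \<Rightarrow> bool" where
  "segment h v a b u S \<longleftrightarrow>
     a < b \<and>
     continuous_map (top_of_set {a<..<b})
       (subtopology (origami h v) (topspace (origami h v) - conical_points h v)) S \<and>
     (\<forall>t\<in>{a<..<b}. torus_has_derivative (covering \<circ> S) u t)"

(* In ereal, x / 0 is infinite with the sign of x (and 0 / 0 = 0). *)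
definition slope :: "real \<times> real \<Rightarrow> ereal" where
  "slope u = ereal (fst u) / ereal (snd u)"

definition segment_length :: "real \<Rightarrow> real \<Rightarrow> real \<times> real \<Rightarrow> real" where
  "segment_length a b u = \<bar>b - a\<bar> * norm u"

lemma slope_horizontal:
  "x > 0 \<Longrightarrow> slope (x, 0) = \<infinity>" "x < 0 \<Longrightarrow> slope (x, 0) = -\<infinity>"
  by (simp_all add: slope_def divide_ereal_def flip: zero_ereal_def)


section \<open>The Ornithorynque\<close>

type_synonym orn_index = "3 \<times> 2 \<times> 2"

definition orn_h :: "orn_index \<Rightarrow> orn_index" where
  "orn_h = (\<lambda>(i, k, l).
     if k = 0 then (if l = 0 then (i + 1, 1, 0) else (i - 1, 1, 1))
     else (if l = 0 then (i, 0, 0) else (i, 0, 1)))"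

definition orn_v :: "orn_index \<Rightarrow> orn_index" where
  "orn_v = (\<lambda>(i, k, l).
     if k = 0 then (if l = 0 then (i - 1, 0, 1) else (i, 0, 0))
     else (if l = 0 then (i + 1, 1, 1) else (i, 1, 0)))"

lemma cases_2: "k = 0 \<or> k = (1 :: 2)"
proof (cases k)
  case (of_int z)
  then have "z = 0 \<or> z = 1" by auto
  with of_int show ?thesis by auto
qed

lemma orn_h_simps [simp]:
  "orn_h (i, 0, 0) = (i + 1, 1, 0)" "orn_h (i, 0, 1) = (i - 1, 1, 1)"
  "orn_h (i, 1, 0) = (i, 0, 0)" "orn_h (i, 1, 1) = (i, 0, 1)"
  by (simp_all add: orn_h_def)

lemma orn_v_simps [simp]:
  "orn_v (i, 0, 0) = (i - 1, 0, 1)" "orn_v (i, 0, 1) = (i, 0, 0)"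
  "orn_v (i, 1, 0) = (i + 1, 1, 1)" "orn_v (i, 1, 1) = (i, 1, 0)"
  by (simp_all add: orn_v_def)

lemma bij_orn_h: "bij orn_h"
proof -
  have "inj orn_h"
    unfolding inj_def using cases_2 by (auto simp: orn_h_def split: if_splits)
  then show ?thesis by (simp add: bij_def finite_UNIV_inj_surj)
qed

lemma bij_orn_v: "bij orn_v"
proof -
  have "inj orn_v"
    unfolding inj_def using cases_2 by (auto simp: orn_v_def split: if_splits)
  then show ?thesis by (simp add: bij_def finite_UNIV_inj_surj)
qed

end

theory Submission
  imports Defs
begin

text \<open>
  By uniqueness of lifts along the covering away from the conical points, a segment that starts at a
  point of a closed square follows a straight line as long as it stays in that square. Rescale so
  that \<open>V\<close> has velocity \<open>(\<sigma>, 1)\<close> with \<open>0 < \<sigma> < 1\<close>, and \<open>H\<close> has velocity \<open>(-1, m)\<close> with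
  \<open>0 \<le> m < 1\<close>. If \<open>V\<close> and \<open>H\<close> cross the same edge, they meet in one of the two adjacent squares; if
  \<open>V\<close> joins bottom to top and \<open>H\<close> joins right to left in the same square, they meet there. Looking at
  the ways in which the two paths can traverse a square, one of these cases always occurs as soon as
  both visit a common square (away from their ends). In the Ornithorynque, five rows of squares
  climbed by \<open>V\<close> and five columns crossed by \<open>H\<close> always have a square in common, and the length
  \<open>\<surd>288 = 12 \<surd>2\<close> provides more than enough of them.
\<close>

abbreviation unit_square :: "(real \<times> real) set" where
  "unit_square \<equiv> {0..1} \<times> {0..1}"

section \<open>The torus and straight paths in it\<close>

lemma torus_proj_eq_iff:
  "torus_proj p = torus_proj q \<longleftrightarrow> fst q - fst p \<in> \<int> \<and> snd q - snd p \<in> \<int>"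
proof
  assume "torus_proj p = torus_proj q"
  moreover have "(q, q) \<in> torus_rel"
    unfolding torus_rel_def by (auto intro!: exI[of _ 0] simp: prod_eq_iff)
  ultimately have "(p, q) \<in> torus_rel"
    by blast
  then show "fst q - fst p \<in> \<int> \<and> snd q - snd p \<in> \<int>"
    by (auto simp: torus_rel_def)
next
  assume "fst q - fst p \<in> \<int> \<and> snd q - snd p \<in> \<int>"
  then obtain m n :: int where "fst q - fst p = of_int m" "snd q - snd p = of_int n"
    by (metis Ints_cases)
  then show "torus_proj p = torus_proj q"
    by (intro torus_proj_eqI) (auto simp: torus_rel_def prod_eq_iff algebra_simps intro!: exI[of _ m] exI[of _ n])
qed

text \<open>Congruence modulo 1 becomes an equality of complex numbers, which a derivative argument
  can establish.\<close>

lemma cis_eq_iff_Ints: "cis (2 * pi * x) = cis (2 * pi * y) \<longleftrightarrow> x - y \<in> \<int>"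
proof -
  have "cis (2 * pi * x) = cis (2 * pi * y) \<longleftrightarrow> cis (2 * pi * (x - y)) = 1"
    by (simp add: right_diff_distrib cis_divide [symmetric])
  also have "\<dots> \<longleftrightarrow> (\<exists>n::int. 2 * pi * (x - y) = of_int (2 * n) * pi)"
    by (simp add: cis_conv_exp exp_eq_1)
  also have "\<dots> \<longleftrightarrow> x - y \<in> \<int>"
    by (auto simp: Ints_def)
  finally show ?thesis .
qed

text \<open>The representatives \<open>r t\<close> may jump by lattice vectors, so \<open>r\<close>
  itself cannot be differentiated. The map \<open>G\<close> ignores such jumps, agrees near each
  time with the same expression in a differentiable local lift \<open>g\<close>, and hence has
  derivative zero; it is constant on the interval.\<close>

lemma torus_affine_coordinate:
  fixes f :: "real \<times> real \<Rightarrow> real"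
  assumes f: "bounded_linear f"
    and f_Ints: "\<And>p q. torus_proj p = torus_proj q \<Longrightarrow> f p - f q \<in> \<int>"
    and deriv: "\<And>t. t \<in> {a<..<b} \<Longrightarrow> torus_has_derivative \<gamma> u t"
    and r: "\<And>t. t \<in> {a<..<b} \<Longrightarrow> \<gamma> t = torus_proj (r t)"
    and "s \<in> {a<..<b}" "t \<in> {a<..<b}"
  shows "f (r t) - f (r s + (t - s) *\<^sub>R u) \<in> \<int>"
proof -
  define G where "G t = cis (2 * pi * (f (r t) - t * f u))" for t
  have "(G has_vector_derivative 0) (at t)" if t: "t \<in> {a<..<b}" for t
  proof -
    obtain g where g: "\<forall>\<^sub>F s in nhds t. \<gamma> s = torus_proj (g s)"
      and g': "(g has_vector_derivative u) (at t)"
      using deriv[OF t] unfolding torus_has_derivative_def by blast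
    have "\<forall>\<^sub>F s in nhds t. s \<in> {a<..<b}"
      using t by (intro eventually_nhds_in_open) auto
    with g have ev: "\<forall>\<^sub>F s in nhds t. cis (2 * pi * (f (g s) - s * f u)) = G s"
    proof eventually_elim
      case (elim s)
      then have "f (g s) - f (r s) \<in> \<int>"
        using f_Ints r by metis
      then show ?case
        unfolding G_def cis_eq_iff_Ints by simp
    qed
    have "((\<lambda>s. f (g s)) has_vector_derivative f u) (at t)"
      using bounded_linear.has_vector_derivative[OF f g'] .
    then have "((\<lambda>s. f (g s)) has_real_derivative f u) (at t)"
      by (simp add: has_real_derivative_iff_has_vector_derivative)
    then have "((\<lambda>s. 2 * pi * (f (g s) - s * f u)) has_real_derivative 0) (at t)"
      by (auto intro!: derivative_eq_intros)
    then have "((\<lambda>s. 2 * pi * (f (g s) - s * f u)) has_vector_derivative 0) (at t)"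
      by (simp add: has_real_derivative_iff_has_vector_derivative)
    moreover have "(cis has_vector_derivative \<i> * cis \<theta>) (at \<theta>)" for \<theta>
      unfolding cis_conv_exp
      by (auto intro!: derivative_eq_intros has_vector_derivative_real_field)
    ultimately have "(cis \<circ> (\<lambda>s. 2 * pi * (f (g s) - s * f u)) has_vector_derivative 0) (at t)"
      using vector_diff_chain_at by fastforce
    moreover have "\<forall>\<^sub>F s in nhds t. s \<in> UNIV \<longrightarrow> (cis \<circ> (\<lambda>s. 2 * pi * (f (g s) - s * f u))) s = G s"
      using ev by (simp add: o_def)
    moreover from this have "(cis \<circ> (\<lambda>s. 2 * pi * (f (g s) - s * f u))) t = G t"
      by (auto dest: eventually_nhds_x_imp_x)
    ultimately show ?thesis
      using has_vector_derivative_cong_ev by blast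
  qed
  then have "\<And>t. t \<in> {a<..<b} \<Longrightarrow> (G has_vector_derivative 0) (at t within {a<..<b})"
    by (blast intro: has_vector_derivative_at_within)
  then have "G t = G s"
    using has_vector_derivative_zero_constant[of "{a<..<b}" G] assms(5,6)
    by (metis convex_real_interval(8))
  then have const: "f (r t) - t * f u - (f (r s) - s * f u) \<in> \<int>"
    unfolding G_def cis_eq_iff_Ints .
  interpret bounded_linear f by (rule f)
  show ?thesis
    using const by (simp add: add diff scale algebra_simps)
qed

text \<open>Representatives are chosen pointwise. By the coordinate statement for \<open>fst\<close>
  and \<open>snd\<close>, they differ by lattice vectors from one affine path.\<close>

lemma torus_affine_lift:
  assumes deriv: "\<And>t. t \<in> {a<..<b} \<Longrightarrow> torus_has_derivative \<gamma> u t"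
  obtains z where "\<And>t. t \<in> {a<..<b} \<Longrightarrow> \<gamma> t = torus_proj (z + t *\<^sub>R u)"
proof (cases "{a<..<b} = {}")
  case True
  then show ?thesis using that by blast
next
  case False
  then obtain s where s: "s \<in> {a<..<b}" by blast
  have "\<exists>p. \<gamma> t = torus_proj p" if t: "t \<in> {a<..<b}" for t
  proof -
    obtain g where "\<forall>\<^sub>F s in nhds t. \<gamma> s = torus_proj (g s)"
      using deriv[OF t] unfolding torus_has_derivative_def by blast
    from eventually_nhds_x_imp_x[OF this] show ?thesis by blast
  qed
  then obtain r where r: "\<And>t. t \<in> {a<..<b} \<Longrightarrow> \<gamma> t = torus_proj (r t)"
    by metis
  have "\<gamma> t = torus_proj ((r s - s *\<^sub>R u) + t *\<^sub>R u)" if t: "t \<in> {a<..<b}" for t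
  proof -
    have eq: "(r s - s *\<^sub>R u) + t *\<^sub>R u = r s + (t - s) *\<^sub>R u"
      by (simp add: algebra_simps)
    have "f (r t) - f (r s + (t - s) *\<^sub>R u) \<in> \<int>" if "f = fst \<or> f = snd" for f
    proof (rule torus_affine_coordinate[OF _ _ deriv r s t])
      show "bounded_linear f"
        using that bounded_linear_fst bounded_linear_snd by blast
      show "f p - f q \<in> \<int>" if "torus_proj p = torus_proj q" for p q
        using that[symmetric] \<open>f = fst \<or> f = snd\<close> unfolding torus_proj_eq_iff by blast
    qed
    then have "torus_proj (r s + (t - s) *\<^sub>R u) = torus_proj (r t)"
      unfolding torus_proj_eq_iff by blast
    then show ?thesis unfolding eq using r[OF t] by simp
  qed
  then show ?thesis using that by blast
qed

section \<open>Lifting straight paths to an origami\<close>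

definition pt :: "('q::finite \<Rightarrow> 'q) \<Rightarrow> ('q \<Rightarrow> 'q) \<Rightarrow> 'q \<times> real \<times> real \<Rightarrow> ('q \<times> real \<times> real) set" where
  "pt h v p = origami_rel h v `` {p}"

lemma covering_pt: "covering (pt h v (j, z)) = torus_proj z"
  unfolding pt_def by (rule covering_class)

lemma equiv_origami_rel: "equiv UNIV (origami_rel h v)"
  unfolding equiv_def refl_on_def sym_def trans_def origami_rel_def
  by (auto intro: equivclp_sym equivclp_trans)

lemma pt_eq_iff: "pt h v p = pt h v q \<longleftrightarrow> equivclp (gluing h v) p q"
  unfolding pt_def using eq_equiv_class_iff[OF equiv_origami_rel, of p q h v]
  by (simp add: origami_rel_def)

lemma pt_right_left: "y \<in> {0..1} \<Longrightarrow> pt h v (j, 1, y) = pt h v (h j, 0, y)"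
  unfolding pt_eq_iff by (simp add: r_into_equivclp gluing.right_left)

lemma pt_top_bottom: "x \<in> {0..1} \<Longrightarrow> pt h v (j, x, 1) = pt h v (v j, x, 0)"
  unfolding pt_eq_iff by (simp add: r_into_equivclp gluing.top_bottom)

lemma topspace_squares: "topspace squares = UNIV \<times> unit_square"
  by (simp add: squares_def)

lemma topspace_origami: "topspace (origami h v) = pt h v ` (UNIV \<times> unit_square)"
  by (auto simp: origami_def topspace_quotient_topology topspace_squares quotient_def pt_def)

lemma continuous_map_pt: "continuous_map squares (origami h v) (pt h v)"
  unfolding continuous_map_def origami_def topspace_quotient_topology
  by (auto simp: openin_quotient_topology quotientI pt_def)

text \<open>Compatibility with the elementary gluings propagates to the generated equivalence
  relation, so \<open>N\<close> is the full preimage of its image.\<close>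

lemma openin_origami_image:
  assumes "openin squares N"
    and saturated: "\<And>p q. gluing h v p q \<Longrightarrow> p \<in> N \<longleftrightarrow> q \<in> N"
  shows "openin (origami h v) (pt h v ` N)"
proof -
  have "p \<in> N \<longleftrightarrow> q \<in> N" if "equivclp (gluing h v) p q" for p q
    using that by (induction rule: equivclp_induct) (use saturated in blast)+
  then have "{p \<in> topspace squares. pt h v p \<in> pt h v ` N} = N"
    using openin_subset[OF assms(1)]
    unfolding image_iff pt_eq_iff by (blast intro: equivclp_refl)
  then show ?thesis
    using assms(1) openin_subset[OF assms(1)]
    unfolding origami_def openin_quotient_topology quotient_def pt_def by auto
qed

text \<open>The union, over all representatives of the class of \<open>p\<close>, of the open boxes
  of radius \<open>e\<close> cut down to the closed squares. One formula serves interior points,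
  edge points and vertices.\<close>

definition coord_nbhd :: "('q::finite \<Rightarrow> 'q) \<Rightarrow> ('q \<Rightarrow> 'q) \<Rightarrow> real \<Rightarrow> 'q \<times> real \<times> real \<Rightarrow> ('q \<times> real \<times> real) set" where
  "coord_nbhd h v e p = {(j, x, y). x \<in> {0..1} \<and> y \<in> {0..1} \<and>
     (\<exists>x'\<in>{0..1}. \<exists>y'\<in>{0..1}. pt h v (j, x', y') = pt h v p \<and> \<bar>x - x'\<bar> < e \<and> \<bar>y - y'\<bar> < e)}"

lemma coord_nbhdI:
  assumes "x \<in> {0..1}" "y \<in> {0..1}" "x' \<in> {0..1}" "y' \<in> {0..1}"
    "pt h v (j, x', y') = pt h v p" "\<bar>x - x'\<bar> < e" "\<bar>y - y'\<bar> < e"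
  shows "(j, x, y) \<in> coord_nbhd h v e p"
  using assms unfolding coord_nbhd_def by blast

lemma coord_nbhd_self:
  assumes "snd p \<in> unit_square" "0 < e"
  shows "p \<in> coord_nbhd h v e p"
proof -
  obtain j x y where "p = (j, x, y)" by (metis surj_pair)
  then show ?thesis
    using assms coord_nbhdI[of x y x y h v j p e] by auto
qed

lemma openin_coord_nbhd: "openin squares (coord_nbhd h v e p)"
proof (subst openin_subopen, intro ballI)
  fix q assume q: "q \<in> coord_nbhd h v e p"
  obtain j x y where jxy: "q = (j, x, y)" by (metis surj_pair)
  obtain x' y' where *: "x' \<in> {0..1}" "y' \<in> {0..1}" "pt h v (j, x', y') = pt h v p"
      "\<bar>x - x'\<bar> < e" "\<bar>y - y'\<bar> < e" "x \<in> {0..1}" "y \<in> {0..1}"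
    using q unfolding jxy coord_nbhd_def by blast
  let ?R = "{x'-e<..<x'+e} \<times> {y'-e<..<y'+e}"
  have "open ?R" by (intro open_Times open_greaterThanLessThan)
  then have "openin squares ({j} \<times> (unit_square \<inter> ?R))"
    unfolding squares_def openin_prod_Times_iff
    by (auto intro: openin_open_Int)
  moreover have "q \<in> {j} \<times> (unit_square \<inter> ?R)"
    using * jxy by auto
  moreover have "{j} \<times> (unit_square \<inter> ?R) \<subseteq> coord_nbhd h v e p"
    using * by (auto intro!: coord_nbhdI[where x' = x' and y' = y'])
  ultimately show "\<exists>T. openin squares T \<and> q \<in> T \<and> T \<subseteq> coord_nbhd h v e p"
    by blast
qed

text \<open>For \<open>c\<close> not an integer, \<open>e\<close> is the distance from
  \<open>c\<close> to the nearest integer; for an integer \<open>c\<close>, distinct integers are at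
  least 1 apart. The bound \<open>1/2\<close> later keeps two boxes of radius \<open>e\<close> from
  reaching points a full unit apart.\<close>

lemma dist_Ints_pos:
  fixes c :: real
  obtains e where "0 < e" "e \<le> 1/2" "\<And>x n. \<lbrakk>x - c \<in> \<int>; n \<in> \<int>; \<bar>n - x\<bar> < e\<rbrakk> \<Longrightarrow> x = n"
proof (cases "c \<in> \<int>")
  case True
  have "x = n" if "x - c \<in> \<int>" "n \<in> \<int>" "\<bar>n - x\<bar> < 1/2" for x n :: real
  proof -
    have "n - x \<in> \<int>"
      using Ints_diff[OF Ints_diff[OF that(2,1)] True] by simp
    then obtain k :: int where k: "n - x = of_int k" by (elim Ints_cases)
    then have "\<bar>real_of_int k\<bar> < 1" using that(3) by linarith
    then have "k = 0" by linarith
    then show ?thesis using k by simp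
  qed
  then show ?thesis using that[of "1/2"] by simp
next
  case False
  define e where "e = min (1/2) (min (frac c) (1 - frac c))"
  have e: "0 < e" "e \<le> 1/2"
    using False frac_lt_1[of c] frac_gt_0_iff[of c] unfolding e_def by (simp, linarith)
  have "x = n" if xn: "x - c \<in> \<int>" "n \<in> \<int>" "\<bar>n - x\<bar> < e" for x n
  proof -
    from Ints_diff[OF xn(2,1)] have "n - (x - c) \<in> \<int>" .
    then obtain k :: int where k: "n - x = of_int k - c"
      by (elim Ints_cases) (simp add: algebra_simps)
    have c: "c = of_int \<lfloor>c\<rfloor> + frac c" by (simp add: frac_def)
    then have *: "n - x = of_int (k - \<lfloor>c\<rfloor>) - frac c" using k by simp
    have "k - \<lfloor>c\<rfloor> \<le> 0 \<or> k - \<lfloor>c\<rfloor> \<ge> 1" by linarith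
    then have "\<bar>n - x\<bar> \<ge> e"
    proof
      assume "k - \<lfloor>c\<rfloor> \<le> 0"
      then have "real_of_int (k - \<lfloor>c\<rfloor>) \<le> 0" by linarith
      then show ?thesis using * unfolding e_def by linarith
    next
      assume "k - \<lfloor>c\<rfloor> \<ge> 1"
      then have "real_of_int (k - \<lfloor>c\<rfloor>) \<ge> 1" by linarith
      then show ?thesis using * unfolding e_def by linarith
    qed
    with xn(3) show ?thesis by simp
  qed
  with e show ?thesis using that by blast
qed

lemma pt_eq_coord_Ints:
  assumes "pt h v (j, x, y) = pt h v (k, a, b)"
  shows "x - a \<in> \<int>" "y - b \<in> \<int>"
proof -
  have "torus_proj (a, b) = torus_proj (x, y)"
    using assms covering_pt by metis
  then show "x - a \<in> \<int>" "y - b \<in> \<int>"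
    unfolding torus_proj_eq_iff by simp_all
qed

text \<open>A square's edge comes within \<open>e\<close> of a point over \<open>(a, b)\<close> only if that point
  lies on the edge; hence the neighbourhood is compatible with the gluing.\<close>

lemma coord_nbhd_saturated:
  assumes ea: "\<And>x n. \<lbrakk>x - a \<in> \<int>; n \<in> \<int>; \<bar>n - x\<bar> < e\<rbrakk> \<Longrightarrow> x = n"
    and eb: "\<And>x n. \<lbrakk>x - b \<in> \<int>; n \<in> \<int>; \<bar>n - x\<bar> < e\<rbrakk> \<Longrightarrow> x = n"
    and glue: "gluing h v p q"
  shows "p \<in> coord_nbhd h v e (k, a, b) \<longleftrightarrow> q \<in> coord_nbhd h v e (k, a, b)"
  using glue
proof cases
  case (right_left y j)
  show ?thesis
  proof
    assume "p \<in> coord_nbhd h v e (k, a, b)"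
    then obtain x' y' where *: "x' \<in> {0..1}" "y' \<in> {0..1}" "pt h v (j, x', y') = pt h v (k, a, b)"
        "\<bar>1 - x'\<bar> < e" "\<bar>y - y'\<bar> < e"
      unfolding right_left coord_nbhd_def by auto
    then have "x' = 1"
      using ea[of x' 1] pt_eq_coord_Ints(1)[OF *(3)] by simp
    with * have "pt h v (h j, 0, y') = pt h v (k, a, b)"
      by (simp add: pt_right_left)
    with * right_left show "q \<in> coord_nbhd h v e (k, a, b)"
      by (auto intro!: coord_nbhdI[where x' = 0 and y' = y'])
  next
    assume "q \<in> coord_nbhd h v e (k, a, b)"
    then obtain x' y' where *: "x' \<in> {0..1}" "y' \<in> {0..1}" "pt h v (h j, x', y') = pt h v (k, a, b)"
        "\<bar>0 - x'\<bar> < e" "\<bar>y - y'\<bar> < e"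
      unfolding right_left coord_nbhd_def by auto
    then have "x' = 0"
      using ea[of x' 0] pt_eq_coord_Ints(1)[OF *(3)] by simp
    with * have "pt h v (j, 1, y') = pt h v (k, a, b)"
      by (simp add: pt_right_left)
    with * right_left show "p \<in> coord_nbhd h v e (k, a, b)"
      by (auto intro!: coord_nbhdI[where x' = 1 and y' = y'])
  qed
next
  case (top_bottom x j)
  show ?thesis
  proof
    assume "p \<in> coord_nbhd h v e (k, a, b)"
    then obtain x' y' where *: "x' \<in> {0..1}" "y' \<in> {0..1}" "pt h v (j, x', y') = pt h v (k, a, b)"
        "\<bar>x - x'\<bar> < e" "\<bar>1 - y'\<bar> < e"
      unfolding top_bottom coord_nbhd_def by auto
    then have "y' = 1"
      using eb[of y' 1] pt_eq_coord_Ints(2)[OF *(3)] by simp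
    with * have "pt h v (v j, x', 0) = pt h v (k, a, b)"
      by (simp add: pt_top_bottom)
    with * top_bottom show "q \<in> coord_nbhd h v e (k, a, b)"
      by (auto intro!: coord_nbhdI[where x' = x' and y' = 0])
  next
    assume "q \<in> coord_nbhd h v e (k, a, b)"
    then obtain x' y' where *: "x' \<in> {0..1}" "y' \<in> {0..1}" "pt h v (v j, x', y') = pt h v (k, a, b)"
        "\<bar>x - x'\<bar> < e" "\<bar>0 - y'\<bar> < e"
      unfolding top_bottom coord_nbhd_def by auto
    then have "y' = 0"
      using eb[of y' 0] pt_eq_coord_Ints(2)[OF *(3)] by simp
    with * have "pt h v (j, x', 1) = pt h v (k, a, b)"
      by (simp add: pt_top_bottom)
    with * top_bottom show "p \<in> coord_nbhd h v e (k, a, b)"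
      by (auto intro!: coord_nbhdI[where x' = x' and y' = 1])
  qed
qed

text \<open>The part of the Hausdorff property that uniqueness of lifts uses. If the two
  neighbourhoods met, some square would contain representatives of \<open>p\<close> and of
  \<open>q\<close> whose coordinates differ by integers of absolute value below 1, so the points
  would coincide.\<close>

lemma fibre_separated:
  assumes p: "p \<in> topspace (origami h v)" and q: "q \<in> topspace (origami h v)"
    and cov: "covering p = covering q" and "p \<noteq> q"
  obtains M N where "openin (origami h v) M" "openin (origami h v) N" "p \<in> M" "q \<in> N" "M \<inter> N = {}"
proof -
  obtain j a b where P: "p = pt h v (j, a, b)" "(a, b) \<in> unit_square"
    using p by (auto simp: topspace_origami)
  obtain k c d where Q: "q = pt h v (k, c, d)" "(c, d) \<in> unit_square"
    using q by (auto simp: topspace_origami)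
  have ac: "c - a \<in> \<int>" "d - b \<in> \<int>"
    using cov unfolding P(1) Q(1) covering_pt torus_proj_eq_iff by simp_all
  obtain e1 where e1: "0 < e1" "e1 \<le> 1/2" "\<And>x n. \<lbrakk>x - a \<in> \<int>; n \<in> \<int>; \<bar>n - x\<bar> < e1\<rbrakk> \<Longrightarrow> x = n"
    using dist_Ints_pos by blast
  obtain e2 where e2: "0 < e2" "e2 \<le> 1/2" "\<And>x n. \<lbrakk>x - b \<in> \<int>; n \<in> \<int>; \<bar>n - x\<bar> < e2\<rbrakk> \<Longrightarrow> x = n"
    using dist_Ints_pos by blast
  define e where "e = min e1 e2"
  have e: "0 < e" "e \<le> 1/2" using e1 e2 by (auto simp: e_def)
  \<comment> \<open>Both points lie over the same torus point, so one radius suits both.\<close>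
  have shift: "x - a \<in> \<int>" if "x - c \<in> \<int>" for x
    using Ints_add[OF that ac(1)] by simp
  have shift': "y - b \<in> \<int>" if "y - d \<in> \<int>" for y
    using Ints_add[OF that ac(2)] by simp
  let ?M = "coord_nbhd h v e (j, a, b)" and ?N = "coord_nbhd h v e (k, c, d)"
  have satM: "\<And>p q. gluing h v p q \<Longrightarrow> p \<in> ?M \<longleftrightarrow> q \<in> ?M"
    by (rule coord_nbhd_saturated) (use e1(3) e2(3) in \<open>auto simp: e_def\<close>)
  have satN: "\<And>p q. gluing h v p q \<Longrightarrow> p \<in> ?N \<longleftrightarrow> q \<in> ?N"
    by (rule coord_nbhd_saturated) (use e1(3) e2(3) shift shift' in \<open>auto simp: e_def\<close>)
  have disj: "?M \<inter> ?N = {}"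
  proof (rule ccontr)
    assume "?M \<inter> ?N \<noteq> {}"
    then obtain i x y where "(i, x, y) \<in> ?M" "(i, x, y) \<in> ?N" by auto
    then obtain x1 y1 x2 y2 where
      1: "pt h v (i, x1, y1) = p" "\<bar>x - x1\<bar> < e" "\<bar>y - y1\<bar> < e" and
      2: "pt h v (i, x2, y2) = q" "\<bar>x - x2\<bar> < e" "\<bar>y - y2\<bar> < e"
      unfolding coord_nbhd_def P(1) Q(1) by auto
    have "x1 - a \<in> \<int>" "y1 - b \<in> \<int>" "x2 - a \<in> \<int>" "y2 - b \<in> \<int>"
      using 1 2 pt_eq_coord_Ints shift shift' unfolding P(1) Q(1) by blast+
    then have "(x1 - a) - (x2 - a) \<in> \<int>" "(y1 - b) - (y2 - b) \<in> \<int>"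
      by (blast intro: Ints_diff)+
    then have "x1 - x2 \<in> \<int>" "y1 - y2 \<in> \<int>"
      by simp_all
    moreover have "\<bar>x1 - x2\<bar> < 1" "\<bar>y1 - y2\<bar> < 1"
      using 1 2 e by linarith+
    ultimately have "x1 = x2" "y1 = y2"
      using Ints_nonzero_abs_less1 by force+
    then show False using 1 2 \<open>p \<noteq> q\<close> by simp
  qed
  have inv: "p \<in> ?M \<longleftrightarrow> q \<in> ?M" if "equivclp (gluing h v) p q" for p q
    using that by (induction rule: equivclp_induct) (use satM in blast)+
  have "pt h v ` ?M \<inter> pt h v ` ?N = {}"
    using inv disj by (auto simp: pt_eq_iff)
  moreover have "(j, a, b) \<in> ?M" "(k, c, d) \<in> ?N"
    using e P(2) Q(2) by (simp_all add: coord_nbhd_self)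
  then have "p \<in> pt h v ` ?M" "q \<in> pt h v ` ?N"
    unfolding P(1) Q(1) by blast+
  moreover have "openin (origami h v) (pt h v ` ?M)"
    using openin_coord_nbhd satM by (rule openin_origami_image)
  moreover have "openin (origami h v) (pt h v ` ?N)"
    using openin_coord_nbhd satN by (rule openin_origami_image)
  ultimately show ?thesis
    using that by metis
qed

text \<open>The agreement set is open because the covering is injective near a regular point; the
  disagreement set is open because points of a fibre can be separated. Connectedness leaves only one
  of them.\<close>

lemma unique_lift:
  assumes I: "connected I"
    and S: "continuous_map (top_of_set I) (origami h v) S"
    and S': "continuous_map (top_of_set I) (origami h v) S'"
    and cov: "\<And>t. t \<in> I \<Longrightarrow> covering (S t) = covering (S' t)"
    and regular: "\<And>t. t \<in> I \<Longrightarrow> S t \<notin> conical_points h v"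
    and "s \<in> I" "S s = S' s" "t \<in> I"
  shows "S t = S' t"
proof -
  let ?A = "{t \<in> I. S t = S' t}" and ?B = "{t \<in> I. S t \<noteq> S' t}"
  have pre: "openin (top_of_set I) {t \<in> I. S t \<in> U}" "openin (top_of_set I) {t \<in> I. S' t \<in> U}"
    if "openin (origami h v) U" for U
    using S S' that by (auto simp: continuous_map_def)
  have in_top: "S t \<in> topspace (origami h v)" "S' t \<in> topspace (origami h v)" if "t \<in> I" for t
    using S S' that by (auto simp: continuous_map_def)
  have "openin (top_of_set I) ?A"
  proof (subst openin_subopen, intro ballI)
    fix t assume "t \<in> ?A"
    then have t: "t \<in> I" "S t = S' t" by blast+
    then obtain U where U: "openin (origami h v) U" "S t \<in> U"
      and hom: "homeomorphic_map (subtopology (origami h v) U) (subtopology torus (covering ` U)) covering"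
      using regular[OF t(1)] in_top[OF t(1)] unfolding conical_points_def by blast
    have inj: "inj_on covering U"
      using homeomorphic_imp_injective_map[OF hom] openin_subset[OF U(1)]
      by (simp add: Int_absorb1)
    let ?T = "{t \<in> I. S t \<in> U} \<inter> {t \<in> I. S' t \<in> U}"
    have "openin (top_of_set I) ?T" using pre[OF U(1)] by (rule openin_Int)
    moreover have "?T \<subseteq> ?A" using inj cov by (auto dest: inj_onD)
    ultimately show "\<exists>T. openin (top_of_set I) T \<and> t \<in> T \<and> T \<subseteq> ?A"
      using t U(2) by (intro exI[of _ ?T]) auto
  qed
  moreover have "openin (top_of_set I) ?B"
  proof (subst openin_subopen, intro ballI)
    fix t assume "t \<in> ?B"
    then have t: "t \<in> I" "S t \<noteq> S' t" by blast+
    obtain M N where MN: "openin (origami h v) M" "openin (origami h v) N" "S t \<in> M" "S' t \<in> N" "M \<inter> N = {}"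
      using fibre_separated[OF in_top[OF t(1)] cov[OF t(1)] t(2)] by blast
    let ?T = "{t \<in> I. S t \<in> M} \<inter> {t \<in> I. S' t \<in> N}"
    have "openin (top_of_set I) ?T" using pre(1)[OF MN(1)] pre(2)[OF MN(2)] by (rule openin_Int)
    moreover have "?T \<subseteq> ?B" using MN(5) by auto
    ultimately show "\<exists>T. openin (top_of_set I) T \<and> t \<in> T \<and> T \<subseteq> ?B"
      using t MN by (intro exI[of _ ?T]) auto
  qed
  moreover have "?A \<union> ?B = I" "?A \<inter> ?B = {}" by auto
  ultimately have "?A = {} \<or> ?B = {}"
    using I unfolding connected_openin by (metis (no_types, lifting) order_refl)
  with \<open>s \<in> I\<close> \<open>S s = S' s\<close> \<open>t \<in> I\<close> show ?thesis by blast
qed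

section \<open>Straight motion inside a square\<close>

lemma segment_affine:
  assumes "segment h v a b u S"
  obtains z where "\<And>t. t \<in> {a<..<b} \<Longrightarrow> covering (S t) = torus_proj (z + t *\<^sub>R u)"
proof -
  have "\<And>t. t \<in> {a<..<b} \<Longrightarrow> torus_has_derivative (covering \<circ> S) u t"
    using assms unfolding segment_def by blast
  from torus_affine_lift[OF this] obtain z where
    "\<And>t. t \<in> {a<..<b} \<Longrightarrow> (covering \<circ> S) t = torus_proj (z + t *\<^sub>R u)" by blast
  then show ?thesis using that unfolding o_def by blast
qed

text \<open>By convexity the affine motion from \<open>p\<close> stays in the closed square between
  the times \<open>s\<close> and \<open>t\<close>. It projects to the same torus path as
  \<open>S\<close> and agrees with it at \<open>s\<close>, so uniqueness of lifts applies.\<close>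

lemma segment_straight_in_square:
  assumes seg: "segment h v a b u S"
    and t: "s \<in> {a<..<b}" "t \<in> {a<..<b}"
    and S: "S s = pt h v (j, p)" and p: "p \<in> unit_square" "p + (t - s) *\<^sub>R u \<in> unit_square"
  shows "S t = pt h v (j, p + (t - s) *\<^sub>R u)"
proof -
  obtain z where z: "\<And>t. t \<in> {a<..<b} \<Longrightarrow> covering (S t) = torus_proj (z + t *\<^sub>R u)"
    using segment_affine[OF seg] by blast
  let ?I = "closed_segment s t"
  have I: "?I \<subseteq> {a<..<b}"
    using t by (intro closed_segment_subset) auto
  have cont: "continuous_map (top_of_set {a<..<b}) (origami h v) S"
    and reg: "\<And>t. t \<in> {a<..<b} \<Longrightarrow> S t \<notin> conical_points h v"
    using seg unfolding segment_def continuous_map_in_subtopology by auto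
  have sq: "p + (r - s) *\<^sub>R u \<in> unit_square" if r: "r \<in> ?I" for r
  proof -
    obtain l where l: "0 \<le> l" "l \<le> 1" "r = (1 - l) *\<^sub>R s + l *\<^sub>R t"
      using r unfolding in_segment by blast
    have "p + (r - s) *\<^sub>R u = (1 - l) *\<^sub>R p + l *\<^sub>R (p + (t - s) *\<^sub>R u)"
      by (simp add: l(3) algebra_simps)
    moreover have "convex unit_square" by (intro convex_Times convex_real_interval)
    ultimately show ?thesis using p l unfolding convex_alt by auto
  qed
  show ?thesis
  proof (rule unique_lift[of ?I h v S "\<lambda>r. pt h v (j, p + (r - s) *\<^sub>R u)" s t])
    show "continuous_map (top_of_set ?I) (origami h v) S"
      using continuous_map_from_subtopology_mono[OF cont I] .
    have "continuous_map (top_of_set ?I) squares (\<lambda>r. (j, p + (r - s) *\<^sub>R u))"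
      unfolding squares_def
    proof (rule continuous_map_pairedI)
      have "continuous_on ?I (\<lambda>r. p + (r - s) *\<^sub>R u)"
        by (intro continuous_intros)
      moreover have "(\<lambda>r. p + (r - s) *\<^sub>R u) \<in> ?I \<rightarrow> unit_square"
        using sq by blast
      ultimately show "continuous_map (top_of_set ?I) (top_of_set unit_square) (\<lambda>r. p + (r - s) *\<^sub>R u)"
        by (simp only: continuous_map_subtopology_eu)
    qed simp
    then show "continuous_map (top_of_set ?I) (origami h v) (\<lambda>r. pt h v (j, p + (r - s) *\<^sub>R u))"
      using continuous_map_compose[OF _ continuous_map_pt] by (simp add: o_def)
    fix r assume "r \<in> ?I"
    then have r: "r \<in> {a<..<b}" using I by blast
    then show "S r \<notin> conical_points h v" by (rule reg)
    have "torus_proj (z + s *\<^sub>R u) = torus_proj p"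
      using z[OF t(1)] S covering_pt by metis
    then show "covering (S r) = covering (pt h v (j, p + (r - s) *\<^sub>R u))"
      unfolding z[OF r] covering_pt torus_proj_eq_iff by (simp add: algebra_simps)
  qed (use S in auto)
qed

text \<open>The consequences of being a segment that the rest of the argument uses, free of topology
  and easily transported along a linear change of parameter.\<close>

definition straight_path :: "('q::finite \<Rightarrow> 'q) \<Rightarrow> ('q \<Rightarrow> 'q) \<Rightarrow>
    real \<Rightarrow> real \<Rightarrow> real \<times> real \<Rightarrow> (real \<Rightarrow> ('q \<times> real \<times> real) set) \<Rightarrow> bool" where
  "straight_path h v a b u S \<longleftrightarrow>
     (\<forall>t\<in>{a<..<b}. S t \<in> topspace (origami h v)) \<and>
     (\<exists>z. \<forall>t\<in>{a<..<b}. covering (S t) = torus_proj (z + t *\<^sub>R u)) \<and>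
     (\<forall>s\<in>{a<..<b}. \<forall>t\<in>{a<..<b}. \<forall>j. \<forall>p\<in>unit_square.
        S s = pt h v (j, p) \<longrightarrow> p + (t - s) *\<^sub>R u \<in> unit_square \<longrightarrow>
        S t = pt h v (j, p + (t - s) *\<^sub>R u))"

lemma straight_path_move:
  assumes "straight_path h v a b u S" "s \<in> {a<..<b}" "t \<in> {a<..<b}"
    "S s = pt h v (j, p)" "p \<in> unit_square" "p + (t - s) *\<^sub>R u \<in> unit_square"
  shows "S t = pt h v (j, p + (t - s) *\<^sub>R u)"
  by (rule assms(1)[unfolded straight_path_def, THEN conjunct2, THEN conjunct2, rule_format,
        OF assms(2,3,5,4,6)])

lemma segment_imp_straight_path:
  assumes "segment h v a b u S"
  shows "straight_path h v a b u S"
  unfolding straight_path_def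
proof (intro conjI ballI allI impI)
  fix t assume "t \<in> {a<..<b}"
  then show "S t \<in> topspace (origami h v)"
    using assms unfolding segment_def continuous_map_def by auto
next
  show "\<exists>z. \<forall>t\<in>{a<..<b}. covering (S t) = torus_proj (z + t *\<^sub>R u)"
    using segment_affine[OF assms] by metis
next
  show "S t = pt h v (j, p + (t - s) *\<^sub>R u)"
    if "s \<in> {a<..<b}" "t \<in> {a<..<b}" "p \<in> unit_square" "S s = pt h v (j, p)"
      "p + (t - s) *\<^sub>R u \<in> unit_square" for s t j p
    using segment_straight_in_square[OF assms that(1,2,4,3,5)] .
qed

lemma mem_rescaled_interval:
  fixes a b l t :: real
  assumes "a < b" "l \<noteq> 0" "min (l * a) (l * b) < t" "t < max (l * a) (l * b)"
  shows "t / l \<in> {a<..<b}"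
  using assms by (cases "l > 0") (auto simp: field_simps min_def max_def split: if_splits)

text \<open>A negative \<open>l\<close> reverses the path and exchanges the ends of the interval,
  hence \<open>min\<close> and \<open>max\<close>.\<close>

lemma straight_path_rescale:
  assumes S: "straight_path h v a b u S" and "a < b" and "l \<noteq> 0"
  shows "straight_path h v (min (l * a) (l * b)) (max (l * a) (l * b)) ((1 / l) *\<^sub>R u) (\<lambda>t. S (t / l))"
proof -
  have I: "t / l \<in> {a<..<b}" if "t \<in> {min (l * a) (l * b)<..<max (l * a) (l * b)}" for t
    using that mem_rescaled_interval[OF \<open>a < b\<close> \<open>l \<noteq> 0\<close>] by simp
  have eq: "(t - s) *\<^sub>R (1 / l) *\<^sub>R u = (t / l - s / l) *\<^sub>R u" for s t
    by (simp add: diff_divide_distrib)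
  obtain z where z: "\<And>t. t \<in> {a<..<b} \<Longrightarrow> covering (S t) = torus_proj (z + t *\<^sub>R u)"
    using S unfolding straight_path_def by blast
  show ?thesis
    unfolding straight_path_def
  proof (intro conjI ballI allI impI)
    show "\<exists>z. \<forall>t\<in>{min (l * a) (l * b)<..<max (l * a) (l * b)}.
        covering (S (t / l)) = torus_proj (z + t *\<^sub>R (1 / l) *\<^sub>R u)"
      using z[OF I] by (intro exI[of _ z]) (simp add: divide_inverse)
    show "S (t / l) \<in> topspace (origami h v)"
      if "t \<in> {min (l * a) (l * b)<..<max (l * a) (l * b)}" for t
      using I[OF that] S unfolding straight_path_def by blast
    show "S (t / l) = pt h v (j, p + (t - s) *\<^sub>R (1 / l) *\<^sub>R u)"
      if "s \<in> {min (l * a) (l * b)<..<max (l * a) (l * b)}"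
        and "t \<in> {min (l * a) (l * b)<..<max (l * a) (l * b)}"
        and "p \<in> unit_square" "S (s / l) = pt h v (j, p)" "p + (t - s) *\<^sub>R (1 / l) *\<^sub>R u \<in> unit_square"
      for s t j p
      using straight_path_move[OF S I[OF that(1)] I[OF that(2)] that(4,3)] that(5) unfolding eq .
  qed
qed

text \<open>Top edges are bottom edges of other squares, and a right end of an edge is the left end
  of the next one; this gives the normal form with \<open>x < 1\<close>.\<close>

lemma pt_over_horizontal:
  assumes p: "p \<in> topspace (origami h v)" and cov: "covering p = torus_proj w" and "snd w \<in> \<int>"
  obtains j x where "p = pt h v (j, x, 0)" "0 \<le> x" "x < 1"
proof -
  obtain j x y where P: "p = pt h v (j, x, y)" "x \<in> {0..1}" "y \<in> {0..1}"
    using p by (auto simp: topspace_origami)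
  have "snd w - y \<in> \<int>"
    using cov unfolding P(1) covering_pt torus_proj_eq_iff by simp
  from Ints_diff[OF \<open>snd w \<in> \<int>\<close> this] have "y \<in> \<int>" by simp
  then obtain n :: int where n: "y = of_int n" by (elim Ints_cases)
  then have "n = 0 \<or> n = 1" using P(3) by auto
  then have "y = 0 \<or> y = 1" using n by auto
  then obtain k where k: "p = pt h v (k, x, 0)"
    using P(1) pt_top_bottom[OF P(2), of h v j] by auto
  show ?thesis
  proof (cases "x = 1")
    case True
    then have "p = pt h v (h k, 0, 0)" using k by (simp add: pt_right_left)
    then show ?thesis using that by force
  next
    case False
    then show ?thesis using k P(2) that by force
  qed
qed

text \<open>The normal form uses right edges because \<open>H\<close> moves leftwards and enters
  squares through them.\<close>

lemma pt_over_vertical: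
  assumes p: "p \<in> topspace (origami h v)" and cov: "covering p = torus_proj w" and "fst w \<in> \<int>"
    and "surj h"
  obtains j y where "p = pt h v (j, 1, y)" "0 \<le> y" "y < 1"
proof -
  obtain j x y where P: "p = pt h v (j, x, y)" "x \<in> {0..1}" "y \<in> {0..1}"
    using p by (auto simp: topspace_origami)
  have "fst w - x \<in> \<int>"
    using cov unfolding P(1) covering_pt torus_proj_eq_iff by simp
  from Ints_diff[OF \<open>fst w \<in> \<int>\<close> this] have "x \<in> \<int>" by simp
  then obtain n :: int where n: "x = of_int n" by (elim Ints_cases)
  then have "n = 0 \<or> n = 1" using P(2) by auto
  then have "x = 0 \<or> x = 1" using n by auto
  moreover obtain i where "j = h i" using \<open>surj h\<close> by (metis surjD)
  ultimately obtain k where k: "p = pt h v (k, 1, y)"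
    using P(1) pt_right_left[OF P(3), of h v i] by auto
  show ?thesis
  proof (cases "y = 1")
    case True
    then have "p = pt h v (v k, 1, 0)" using k by (simp add: pt_top_bottom)
    then show ?thesis using that by force
  next
    case False
    then show ?thesis using k P(3) that by force
  qed
qed

section \<open>Two disjoint straight paths visit disjoint sets of squares\<close>

text \<open>For \<open>f = v\<close>, \<open>g = h\<close>: a path of slope in \<open>(0, 1)\<close> that enters the square \<open>j\<close> from below
  either leaves through the top, or passes to \<open>h j\<close> and leaves that square through the top.\<close>

primrec run :: "('q \<Rightarrow> 'q) \<Rightarrow> ('q \<Rightarrow> 'q) \<Rightarrow> nat \<Rightarrow> 'q set \<Rightarrow> 'q \<Rightarrow> bool" where
  "run f g 0 W j \<longleftrightarrow> j \<in> W"
| "run f g (Suc n) W j \<longleftrightarrow> j \<in> W \<and> (run f g n W (f j) \<or> g j \<in> W \<and> run f g n W (f (g j)))"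

text \<open>Velocities are normalised so that in unit time \<open>V\<close> climbs one row and
  \<open>H\<close> crosses one column leftwards. The value \<open>m = 0\<close> covers a horizontal
  \<open>H\<close>.\<close>

locale disjoint_straight_paths =
  fixes h v :: "'q::finite \<Rightarrow> 'q" and V H :: "real \<Rightarrow> ('q \<times> real \<times> real) set"
    and a b c d \<sigma> m :: real
  assumes surj_h: "surj h" and surj_v: "surj v"
    and \<sigma>: "0 < \<sigma>" "\<sigma> < 1" and m: "0 \<le> m" "m < 1"
    and V: "straight_path h v c d (\<sigma>, 1) V"
    and H: "straight_path h v a b (-1, m) H"
    and disjoint: "\<lbrakk>c < s; s < d; a < t; t < b\<rbrakk> \<Longrightarrow> V s \<noteq> H t"
begin

abbreviation P :: "'q \<Rightarrow> real \<Rightarrow> real \<Rightarrow> ('q \<times> real \<times> real) set" where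
  "P j x y \<equiv> pt h v (j, x, y)"

section \<open>Meeting points near edges and inside squares\<close>

lemma V_move:
  assumes "V s = P j x y" "c < s" "s < d" "c < s + r" "s + r < d"
    "0 \<le> x" "x \<le> 1" "0 \<le> y" "y \<le> 1" "0 \<le> x + \<sigma> * r" "x + \<sigma> * r \<le> 1" "0 \<le> y + r" "y + r \<le> 1"
  shows "V (s + r) = P j (x + \<sigma> * r) (y + r)"
proof -
  have "s \<in> {c<..<d}" "s + r \<in> {c<..<d}" "(x, y) \<in> unit_square" "(x + \<sigma> * r, y + r) \<in> unit_square"
    using assms by auto
  then show ?thesis
    using straight_path_move[OF V, of s "s + r" j "(x, y)"] assms(1) by (simp add: mult.commute)
qed

lemma H_move:
  assumes "H s = P j x y" "a < s" "s < b" "a < s + r" "s + r < b"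
    "0 \<le> x" "x \<le> 1" "0 \<le> y" "y \<le> 1" "0 \<le> x - r" "x - r \<le> 1" "0 \<le> y + m * r" "y + m * r \<le> 1"
  shows "H (s + r) = P j (x - r) (y + m * r)"
proof -
  have "s \<in> {a<..<b}" "s + r \<in> {a<..<b}" "(x, y) \<in> unit_square" "(x - r, y + m * r) \<in> unit_square"
    using assms by auto
  then show ?thesis
    using straight_path_move[OF H, of s "s + r" j "(x, y)"] assms(1) by (simp add: mult.commute)
qed

text \<open>The factor \<open>1 + \<sigma> * m\<close> is the determinant of the directions
  \<open>(\<sigma>, 1)\<close> and \<open>(-1, m)\<close>. For a horizontal gap \<open>e\<close>,
  \<open>H\<close> runs for time \<open>r\<close> and \<open>V\<close> for \<open>m * r\<close>; for
  a vertical gap, \<open>V\<close> runs for \<open>r\<close> and \<open>H\<close> for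
  \<open>\<sigma> * r\<close>.\<close>

lemma crossing_time:
  assumes "0 \<le> e" "e \<le> 1"
  obtains r where "0 \<le> r" "r \<le> 1" "r + \<sigma> * (m * r) = e"
    "0 \<le> m * r" "m * r \<le> 1" "0 \<le> \<sigma> * r" "\<sigma> * r \<le> 1" "0 \<le> \<sigma> * (m * r)"
proof -
  have pos: "0 \<le> \<sigma> * m" using \<sigma> m by simp
  define r where "r = e / (1 + \<sigma> * m)"
  have r0: "0 \<le> r" using assms pos by (simp add: r_def)
  have "r * (1 + \<sigma> * m) = e" using pos by (simp add: r_def)
  then have eq: "r + \<sigma> * (m * r) = e" by (simp add: algebra_simps)
  have "0 \<le> \<sigma> * (m * r)" using \<sigma> m r0 by simp
  then have r1: "r \<le> 1" using eq assms by linarith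
  have "m * r \<le> 1 * 1" "\<sigma> * r \<le> 1 * 1" using \<sigma> m r0 r1 by (intro mult_mono; simp)+
  then show ?thesis using that[of r] r0 r1 eq \<sigma> m by simp
qed

text \<open>If \<open>H\<close> crosses the edge to the right of \<open>V\<close>, the paths meet in the square above the edge,
  otherwise in the square below it.\<close>

lemma no_common_bottom_edge:
  assumes Vs: "V s = P q x 0" and Ht: "H t = P q x' 0"
    and x: "0 \<le> x" "x \<le> 1" "0 \<le> x'" "x' \<le> 1"
    and s: "c < s - 1" "s + 1 < d" and t: "a < t - 1" "t + 1 < b"
  shows False
proof (cases "x \<le> x'")
  case True
  then obtain r where r: "0 \<le> r" "r \<le> 1" "r + \<sigma> * (m * r) = x' - x" "0 \<le> m * r" "m * r \<le> 1" "0 \<le> \<sigma> * (m * r)"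
    using crossing_time[of "x' - x"] x by auto
  have "V (s + m * r) = P q (x + \<sigma> * (m * r)) (0 + m * r)"
    by (rule V_move[OF Vs]) (use x s r in linarith)+
  moreover have "H (t + r) = P q (x' - r) (0 + m * r)"
    by (rule H_move[OF Ht]) (use x t r in linarith)+
  moreover have "x + \<sigma> * (m * r) = x' - r" using r by linarith
  ultimately have "V (s + m * r) = H (t + r)" by simp
  then show False using disjoint[of "s + m * r" "t + r"] s t r by simp
next
  case False
  then obtain r where r: "0 \<le> r" "r \<le> 1" "r + \<sigma> * (m * r) = x - x'" "0 \<le> m * r" "m * r \<le> 1" "0 \<le> \<sigma> * (m * r)"
    using crossing_time[of "x - x'"] x by auto
  obtain k where k: "q = v k" using surj_v by (metis surjD)
  have Vs': "V s = P k x 1" and Ht': "H t = P k x' 1"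
    using Vs Ht k x by (simp_all add: pt_top_bottom)
  have "V (s + - (m * r)) = P k (x + \<sigma> * - (m * r)) (1 + - (m * r))"
    by (rule V_move[OF Vs']) (use x s r in simp_all)
  moreover have "H (t + - r) = P k (x' - - r) (1 + m * - r)"
    by (rule H_move[OF Ht']) (use x t r in simp_all)
  moreover have "x + \<sigma> * - (m * r) = x' - - r" using r by simp
  ultimately have "V (s + - (m * r)) = H (t + - r)" by simp
  then show False using disjoint[of "s + - (m * r)" "t + - r"] s t r by simp
qed

text \<open>If \<open>V\<close> crosses the edge no higher than \<open>H\<close>, the paths meet in
  the square to the right of the edge, otherwise in the one to the left. One path is followed
  forwards and the other backwards, which is why unit margins are asked on both sides.\<close>

lemma no_common_left_edge:
  assumes Vs: "V s = P q 0 y" and Ht: "H t = P q 0 y'"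
    and y: "0 \<le> y" "y \<le> 1" "0 \<le> y'" "y' \<le> 1"
    and s: "c < s - 1" "s + 1 < d" and t: "a < t - 1" "t + 1 < b"
  shows False
proof (cases "y \<le> y'")
  case True
  then obtain r where r: "0 \<le> r" "r \<le> 1" "r + m * (\<sigma> * r) = y' - y" "0 \<le> \<sigma> * r" "\<sigma> * r \<le> 1" "0 \<le> m * (\<sigma> * r)"
    using crossing_time[of "y' - y"] y by (auto simp: mult.left_commute)
  have "V (s + r) = P q (0 + \<sigma> * r) (y + r)"
    by (rule V_move[OF Vs]) (use y s r in linarith)+
  moreover have "H (t + - (\<sigma> * r)) = P q (0 - - (\<sigma> * r)) (y' + m * - (\<sigma> * r))"
    by (rule H_move[OF Ht]) (use y t r in simp_all)
  moreover have "y + r = y' + m * - (\<sigma> * r)" using r by simp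
  ultimately have "V (s + r) = H (t + - (\<sigma> * r))" by simp
  then show False using disjoint[of "s + r" "t + - (\<sigma> * r)"] s t r by simp
next
  case False
  then obtain r where r: "0 \<le> r" "r \<le> 1" "r + m * (\<sigma> * r) = y - y'" "0 \<le> \<sigma> * r" "\<sigma> * r \<le> 1" "0 \<le> m * (\<sigma> * r)"
    using crossing_time[of "y - y'"] y by (auto simp: mult.left_commute)
  obtain k where k: "q = h k" using surj_h by (metis surjD)
  have Vs': "V s = P k 1 y" and Ht': "H t = P k 1 y'"
    using Vs Ht k y by (simp_all add: pt_right_left)
  have "V (s + - r) = P k (1 + \<sigma> * - r) (y + - r)"
    by (rule V_move[OF Vs']) (use y s r in simp_all)
  moreover have "H (t + \<sigma> * r) = P k (1 - \<sigma> * r) (y' + m * (\<sigma> * r))"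
    by (rule H_move[OF Ht']) (use y t r in linarith)+
  moreover have "y + - r = y' + m * (\<sigma> * r)" using r by simp
  ultimately have "V (s + - r) = H (t + \<sigma> * r)" by simp
  then show False using disjoint[of "s + - r" "t + \<sigma> * r"] s t r by simp
qed

text \<open>After time \<open>y + m * r\<close>, \<open>V\<close> is as high as \<open>H\<close> is
  after time \<open>r\<close>. Equating the horizontal positions gives the equation of
  \<open>crossing_time\<close> with \<open>e = 1 - x - \<sigma> * y\<close>.\<close>

lemma no_full_crossing:
  assumes Vs: "V s = P q x 0" and Ht: "H t = P q 1 y"
    and x: "0 \<le> x" "x + \<sigma> \<le> 1" and y: "0 \<le> y" "y + m \<le> 1"
    and s: "c < s" "s + 1 < d" and t: "a < t" "t + 1 < b"
  shows False
proof -
  have "y \<le> 1" using y m by linarith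
  have \<sigma>y: "0 \<le> \<sigma> * y" using \<sigma> y by simp
  have "\<sigma> * y \<le> \<sigma> * 1" by (rule mult_left_mono) (use \<open>y \<le> 1\<close> \<sigma> in simp_all)
  then have e: "0 \<le> 1 - x - \<sigma> * y" "1 - x - \<sigma> * y \<le> 1" using x \<sigma>y by linarith+
  obtain r where r: "0 \<le> r" "r \<le> 1" "r + \<sigma> * (m * r) = 1 - x - \<sigma> * y" "0 \<le> m * r"
    by (rule crossing_time[OF e]) (use that in blast)
  have "m * r \<le> m * 1" using r m by (intro mult_left_mono)
  then have mr: "m * r \<le> m" by simp
  have dist: "\<sigma> * (y + m * r) = \<sigma> * y + \<sigma> * (m * r)" by (simp add: distrib_left)
  have "0 \<le> \<sigma> * (y + m * r)" using \<sigma> r y by simp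
  then have "V (s + (y + m * r)) = P q (x + \<sigma> * (y + m * r)) (0 + (y + m * r))"
    by (intro V_move[OF Vs]) (use x y s r mr dist \<sigma> in linarith)+
  moreover have "H (t + r) = P q (1 - r) (y + m * r)"
    by (rule H_move[OF Ht]) (use \<open>y \<le> 1\<close> y t r mr in linarith)+
  moreover have "x + \<sigma> * (y + m * r) = 1 - r" using r dist by linarith
  ultimately have "V (s + (y + m * r)) = H (t + r)" by simp
  then show False using disjoint[of "s + (y + m * r)" "t + r"] s t r y mr by simp
qed

text \<open>Since \<open>\<sigma> < 1\<close>, at most one vertical edge is passed per row. A path
  ending exactly in the corner, \<open>x + \<sigma> = 1\<close>, is counted as passing to
  \<open>h j\<close>, so that the next abscissa is again below 1.\<close>

lemma V_row:
  assumes Vs: "V s = P j x 0" and x: "0 \<le> x" "x < 1" and s: "c < s" "s + 1 < d"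
  shows "x + \<sigma> < 1 \<Longrightarrow> V (s + 1) = P (v j) (x + \<sigma>) 0"
    and "1 \<le> x + \<sigma> \<Longrightarrow> \<exists>y. 0 \<le> y \<and> y \<le> 1 \<and> V (s + y) = P (h j) 0 y"
    and "1 \<le> x + \<sigma> \<Longrightarrow> V (s + 1) = P (v (h j)) (x + \<sigma> - 1) 0"
proof -
  assume less: "x + \<sigma> < 1"
  have "V (s + 1) = P j (x + \<sigma> * 1) (0 + 1)"
    by (rule V_move[OF Vs]) (use x s \<sigma> less in simp_all)
  then show "V (s + 1) = P (v j) (x + \<sigma>) 0"
    using x \<sigma> less by (simp add: pt_top_bottom)
next
  assume wrap: "1 \<le> x + \<sigma>"
  define y where "y = (1 - x) / \<sigma>"
  have y: "0 \<le> y" "y \<le> 1" "\<sigma> * y = 1 - x"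
    using x \<sigma> wrap by (auto simp: y_def field_simps)
  have "V (s + y) = P j (x + \<sigma> * y) (0 + y)"
    by (rule V_move[OF Vs]) (use x s \<sigma> y in simp_all)
  then have Vy: "V (s + y) = P (h j) 0 y"
    using y by (simp add: pt_right_left)
  then show "\<exists>y. 0 \<le> y \<and> y \<le> 1 \<and> V (s + y) = P (h j) 0 y"
    using y by blast
  have dist: "\<sigma> * (1 - y) = x + \<sigma> - 1" using y by (simp add: right_diff_distrib)
  have "V ((s + y) + (1 - y)) = P (h j) (0 + \<sigma> * (1 - y)) (y + (1 - y))"
    by (rule V_move[OF Vy]) (use x s \<sigma> y dist wrap in linarith)+
  then show "V (s + 1) = P (v (h j)) (x + \<sigma> - 1) 0"
    using x \<sigma> wrap by (simp add: dist pt_top_bottom)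
qed

text \<open>The analogue of \<open>V_row\<close> for leftward motion: \<open>H\<close> reaches
  abscissa \<open>x\<close> after time \<open>1 - x\<close>. It is left on the left edge of the last
  square of the column.\<close>

lemma H_column:
  assumes Ht: "H t = P k 1 y" and y: "0 \<le> y" "y < 1" and t: "a < t" "t + 1 < b"
  shows "y + m < 1 \<Longrightarrow> H (t + 1) = P k 0 (y + m)"
    and "1 \<le> y + m \<Longrightarrow> \<exists>x. 0 \<le> x \<and> x \<le> 1 \<and> H (t + (1 - x)) = P (v k) x 0"
    and "1 \<le> y + m \<Longrightarrow> H (t + 1) = P (v k) 0 (y + m - 1)"
proof -
  assume less: "y + m < 1"
  have "H (t + 1) = P k (1 - 1) (y + m * 1)"
    by (rule H_move[OF Ht]) (use y t m less in simp_all)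
  then show "H (t + 1) = P k 0 (y + m)" by simp
next
  assume wrap: "1 \<le> y + m"
  then have "0 < m" using y by linarith
  define x where "x = 1 - (1 - y) / m"
  have x: "0 \<le> x" "x \<le> 1" "m * (1 - x) = 1 - y"
    using y \<open>0 < m\<close> wrap by (auto simp: x_def field_simps)
  have "H (t + (1 - x)) = P k (1 - (1 - x)) (y + m * (1 - x))"
    by (rule H_move[OF Ht]) (use x t y in linarith)+
  then have Hx: "H (t + (1 - x)) = P (v k) x 0"
    using x by (simp add: pt_top_bottom)
  then show "\<exists>x. 0 \<le> x \<and> x \<le> 1 \<and> H (t + (1 - x)) = P (v k) x 0"
    using x by blast
  have dist: "m * x = y + m - 1" using x by (simp add: right_diff_distrib)
  have "H ((t + (1 - x)) + x) = P (v k) (x - x) (0 + m * x)"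
    by (rule H_move[OF Hx]) (use x y t m dist wrap in linarith)+
  then show "H (t + 1) = P (v k) 0 (y + m - 1)" by (simp add: dist)
qed

text \<open>Squares are recorded row by row, including the second one when \<open>V\<close> passes a
  vertical edge. The margins leave room for the unit of time around each crossing that the edge
  lemmas ask for.\<close>

definition V_squares :: "'q set" where
  "V_squares = {q. \<exists>s j x. c + 1 < s \<and> s + 3 < d \<and> V s = P j x 0 \<and> 0 \<le> x \<and> x < 1 \<and>
     (q = j \<or> 1 \<le> x + \<sigma> \<and> q = h j)}"

definition H_squares :: "'q set" where
  "H_squares = {q. \<exists>t k y. a + 1 < t \<and> t + 3 < b \<and> H t = P k 1 y \<and> 0 \<le> y \<and> y < 1 \<and>
     (q = k \<or> 1 \<le> y + m \<and> q = v k)}"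

text \<open>The cases are whether \<open>V\<close> passes a right edge in its row and whether
  \<open>H\<close> passes a top edge in its column. If neither does, a common square is fully
  crossed by both; otherwise a common square forces a common edge.\<close>

lemma V_H_squares_disjoint: "V_squares \<inter> H_squares = {}"
proof (rule ccontr)
  assume "V_squares \<inter> H_squares \<noteq> {}"
  then obtain q where "q \<in> V_squares" "q \<in> H_squares" by blast
  then obtain s j x t k y
    where s: "c + 1 < s" "s + 3 < d" and Vs: "V s = P j x 0" and x: "0 \<le> x" "x < 1"
      and qV: "q = j \<or> 1 \<le> x + \<sigma> \<and> q = h j"
      and t: "a + 1 < t" "t + 3 < b" and Ht: "H t = P k 1 y" and y: "0 \<le> y" "y < 1"
      and qH: "q = k \<or> 1 \<le> y + m \<and> q = v k"
    unfolding V_squares_def H_squares_def by blast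
  have s': "c < s" "s + 1 < d" and t': "a < t" "t + 1 < b" using s t by linarith+
  note V_row = V_row[OF Vs x s'] and H_column = H_column[OF Ht y t']
  have right_k: "H t = P (h k) 0 y" using Ht y by (simp add: pt_right_left)
  \<comment> \<open>Here \<open>H\<close> crosses the very bottom edge through which
    \<open>V\<close> enters \<open>j\<close>.\<close>
  have bottom: "j \<noteq> v k" if wrap: "1 \<le> y + m"
  proof
    assume "j = v k"
    obtain x' where "0 \<le> x'" "x' \<le> 1" "H (t + (1 - x')) = P (v k) x' 0"
      using H_column(2)[OF wrap] by blast
    then show False
      using no_common_bottom_edge[of s j x "t + (1 - x')" x'] Vs \<open>j = v k\<close> x s t by simp
  qed
  \<comment> \<open>Here \<open>V\<close> crosses the very right edge through which \<open>H\<close>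
    enters \<open>k\<close>.\<close>
  have left: "k \<noteq> j" if wrap: "1 \<le> x + \<sigma>"
  proof
    assume "k = j"
    obtain y' where "0 \<le> y'" "y' \<le> 1" "V (s + y') = P (h j) 0 y'"
      using V_row(2)[OF wrap] by blast
    then show False
      using no_common_left_edge[of "s + y'" "h j" y' t y] right_k \<open>k = j\<close> y s t by simp
  qed
  show False
  proof (cases "1 \<le> x + \<sigma>"; cases "1 \<le> y + m")
    assume "\<not> 1 \<le> x + \<sigma>" "\<not> 1 \<le> y + m"
    then have "j = k" using qV qH by blast
    then show False
      using no_full_crossing[of s j x t y] Vs Ht x y s' t' \<open>\<not> 1 \<le> x + \<sigma>\<close> \<open>\<not> 1 \<le> y + m\<close> by simp
  next
    assume nw: "\<not> 1 \<le> x + \<sigma>" and wrap: "1 \<le> y + m"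
    then have "j = k" using qV qH bottom[OF wrap] by blast
    obtain x' where x': "0 \<le> x'" "x' \<le> 1" "H (t + (1 - x')) = P (v k) x' 0"
      using H_column(2)[OF wrap] by blast
    have "V (s + 1) = P (v j) (x + \<sigma>) 0" using V_row(1) nw by linarith
    then show False
      using no_common_bottom_edge[of "s + 1" "v j" "x + \<sigma>" "t + (1 - x')" x'] x' nw \<open>j = k\<close> x \<sigma> s t by simp
  next
    assume wrap: "1 \<le> x + \<sigma>" and nw: "\<not> 1 \<le> y + m"
    then have "h j = k" using qV qH left[OF wrap] by blast
    obtain y' where y': "0 \<le> y'" "y' \<le> 1" "V (s + y') = P (h j) 0 y'"
      using V_row(2)[OF wrap] by blast
    have "H (t + 1) = P k 0 (y + m)" using H_column(1) nw by linarith
    then show False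
      using no_common_left_edge[of "s + y'" "h j" y' "t + 1" "y + m"] y' nw \<open>h j = k\<close> y m s t by simp
  next
    assume wV: "1 \<le> x + \<sigma>" and wH: "1 \<le> y + m"
    obtain x' where x': "0 \<le> x'" "x' \<le> 1" "H (t + (1 - x')) = P (v k) x' 0"
      using H_column(2)[OF wH] by blast
    obtain y' where y': "0 \<le> y'" "y' \<le> 1" "V (s + y') = P (h j) 0 y'"
      using V_row(2)[OF wV] by blast
    have "h j = k \<or> h j = v k" using qV qH left[OF wV] bottom[OF wH] by blast
    then show False
    proof
      assume "h j = k"
      then show False
        using no_common_bottom_edge[of "s + 1" "v (h j)" "x + \<sigma> - 1" "t + (1 - x')" x'] x'
          V_row(3)[OF wV] wV x \<sigma> s t by simp
    next
      assume "h j = v k"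
      then show False
        using no_common_left_edge[of "s + y'" "h j" y' "t + 1" "y + m - 1"] y'
          H_column(3)[OF wH] wH y m s t by simp
    qed
  qed
qed

section \<open>Itineraries of squares\<close>

lemma run_V_squares:
  assumes "V s = P j x 0" "0 \<le> x" "x < 1" "c + 1 < s" "s + real n + 3 < d"
  shows "run v h n V_squares j"
  using assms
proof (induction n arbitrary: s j x)
  case 0
  then show ?case unfolding V_squares_def by auto
next
  case (Suc n)
  have s: "c < s" "s + 1 < d" "s + 3 < d" using Suc.prems by simp_all
  note row = V_row[OF Suc.prems(1-3) s(1,2)]
  have j: "j \<in> V_squares"
    unfolding V_squares_def using Suc.prems s by blast
  show ?case
  proof (cases "x + \<sigma> < 1")
    case True
    have "run v h n V_squares (v j)"
      by (rule Suc.IH[OF row(1)[OF True]]) (use True Suc.prems \<sigma> in simp_all)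
    then show ?thesis using j by simp
  next
    case False
    then have wrap: "1 \<le> x + \<sigma>" by simp
    have "run v h n V_squares (v (h j))"
      by (rule Suc.IH[OF row(3)[OF wrap]]) (use wrap Suc.prems \<sigma> in simp_all)
    moreover have "h j \<in> V_squares"
      unfolding V_squares_def using Suc.prems s wrap by blast
    ultimately show ?thesis using j by simp
  qed
qed

lemma run_H_squares:
  assumes "H t = P k 1 y" "0 \<le> y" "y < 1" "a + 1 < t" "t + real n + 3 < b"
  shows "run (inv h) v n H_squares k"
  using assms
proof (induction n arbitrary: t k y)
  case 0
  then show ?case unfolding H_squares_def by auto
next
  case (Suc n)
  have t: "a < t" "t + 1 < b" "t + 3 < b" using Suc.prems by simp_all
  note column = H_column[OF Suc.prems(1-3) t(1,2)]
  \<comment> \<open>The left edge of \<open>q\<close> is the right edge of \<open>inv h q\<close>,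
    where the next column starts.\<close>
  have left: "P (inv h q) 1 y' = P q 0 y'" if "0 \<le> y'" "y' \<le> 1" for q y'
    using that by (simp add: pt_right_left surj_f_inv_f[OF surj_h])
  have k: "k \<in> H_squares"
    unfolding H_squares_def using Suc.prems t by blast
  show ?case
  proof (cases "y + m < 1")
    case True
    have "H (t + 1) = P (inv h k) 1 (y + m)"
      using column(1)[OF True] left[of "y + m" k] True Suc.prems m by simp
    then have "run (inv h) v n H_squares (inv h k)"
      by (rule Suc.IH) (use True Suc.prems m in simp_all)
    then show ?thesis using k by simp
  next
    case False
    then have wrap: "1 \<le> y + m" by simp
    have "H (t + 1) = P (inv h (v k)) 1 (y + m - 1)"
      using column(3)[OF wrap] left[of "y + m - 1" "v k"] wrap Suc.prems m by simp
    then have "run (inv h) v n H_squares (inv h (v k))"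
      by (rule Suc.IH) (use wrap Suc.prems m in simp_all)
    moreover have "v k \<in> H_squares"
      unfolding H_squares_def using Suc.prems t wrap by blast
    ultimately show ?thesis using k by simp
  qed
qed

text \<open>Of the 5 extra units of time, at most 2 pass before the first usable horizontal edge and
  3 are the final margin of \<open>V_squares\<close>.\<close>

lemma long_run_V:
  assumes "real n + 5 < d - c"
  obtains j where "run v h n V_squares j"
proof -
  obtain z where z: "\<And>t. t \<in> {c<..<d} \<Longrightarrow> covering (V t) = torus_proj (z + t *\<^sub>R (\<sigma>, 1))"
    using V unfolding straight_path_def by blast
  \<comment> \<open>The first time after \<open>c + 1\<close> at which the height
    \<open>snd z + s\<close> is an integer.\<close>
  define s where "s = of_int (\<lfloor>snd z + c + 1\<rfloor> + 1) - snd z"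
  have s: "c + 1 < s" "s \<le> c + 2" unfolding s_def by linarith+
  then have I: "s \<in> {c<..<d}" using assms by simp
  obtain j x where "V s = P j x 0" "0 \<le> x" "x < 1"
  proof (rule pt_over_horizontal)
    show "V s \<in> topspace (origami h v)" using V I unfolding straight_path_def by blast
    show "covering (V s) = torus_proj (z + s *\<^sub>R (\<sigma>, 1))" using z I .
    show "snd (z + s *\<^sub>R (\<sigma>, 1)) \<in> \<int>" by (simp add: s_def)
  qed blast
  then have "run v h n V_squares j"
    by (rule run_V_squares) (use s assms in linarith)+
  then show ?thesis using that by blast
qed

lemma long_run_H:
  assumes "real n + 5 < b - a"
  obtains k where "run (inv h) v n H_squares k"
proof -
  obtain z where z: "\<And>t. t \<in> {a<..<b} \<Longrightarrow> covering (H t) = torus_proj (z + t *\<^sub>R (-1, m))"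
    using H unfolding straight_path_def by blast
  \<comment> \<open>The first time after \<open>a + 1\<close> at which the abscissa
    \<open>fst z - t\<close> is an integer.\<close>
  define t where "t = fst z + of_int (\<lfloor>a + 1 - fst z\<rfloor> + 1)"
  have t: "a + 1 < t" "t \<le> a + 2" unfolding t_def by linarith+
  then have I: "t \<in> {a<..<b}" using assms by simp
  obtain k y where "H t = P k 1 y" "0 \<le> y" "y < 1"
  proof (rule pt_over_vertical)
    show "H t \<in> topspace (origami h v)" using H I unfolding straight_path_def by blast
    show "covering (H t) = torus_proj (z + t *\<^sub>R (-1, m))" using z I .
    show "fst (z + t *\<^sub>R (-1, m)) \<in> \<int>" by (simp add: t_def)
  qed (use surj_h in blast)+
  then have "run (inv h) v n H_squares k"
    by (rule run_H_squares) (use t assms in linarith)+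
  then show ?thesis using that by blast
qed

end

section \<open>The Ornithorynque\<close>

lemma run_mono: "run f g n W j \<Longrightarrow> W \<subseteq> W' \<Longrightarrow> run f g n W' j"
  by (induction n arbitrary: j) auto

lemma mod_3_simps: "(3 :: 3) = 0" "(-1 :: 3) = 2" "(-2 :: 3) = 1" "(4 :: 3) = 1"
  by simp_all

lemma orn_index_cases:
  fixes j :: orn_index
  shows "j \<in> {0, 1, 2} \<times> {0, 1} \<times> {0, 1}"
proof -
  obtain i k l where j: "j = (i, k, l)" by (metis surj_pair)
  have "i \<in> {0, 1, 2}"
    using exhaust_3[of i] by (auto simp: mod_3_simps)
  then show ?thesis
    using j cases_2[of k] cases_2[of l] by auto
qed

lemma inv_orn_h:
  "inv orn_h (i, 0, 0) = (i, 1, 0)" "inv orn_h (i, 0, 1) = (i, 1, 1)"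
  "inv orn_h (i, 1, 0) = (i - 1, 0, 0)" "inv orn_h (i, 1, 1) = (i + 1, 0, 1)"
  by (rule inv_f_eq[OF bij_is_inj[OF bij_orn_h]]; simp)+

text \<open>Runs are monotone in the set, so it is enough to refute \<open>W' = - W\<close>. What remains is
  a propositional statement in the twelve truth values \<open>j \<in> W\<close>.\<close>

lemma orn_runs_meet:
  assumes "run orn_v orn_h 4 W j" "run (inv orn_h) orn_v 4 W' k"
  shows "W \<inter> W' \<noteq> {}"
proof
  assume "W \<inter> W' = {}"
  then have "W' \<subseteq> - W" by blast
  then have H: "run (inv orn_h) orn_v 4 (- W) k"
    using run_mono[OF assms(2)] by blast
  have V: "run orn_v orn_h 4 W j" by (rule assms(1))
  have j: "j \<in> {0, 1, 2} \<times> {0, 1} \<times> {0, 1}" and k: "k \<in> {0, 1, 2} \<times> {0, 1} \<times> {0, 1}"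
    by (rule orn_index_cases)+
  \<comment> \<open>Four successor steps of \<open>run\<close> describe five rows or columns, the
    starting one included.\<close>
  have step: "(4::nat) = Suc (Suc (Suc (Suc 0)))" by simp
  have "\<exists>j\<in>{0, 1, 2} \<times> {0, 1} \<times> {0, 1}. run orn_v orn_h 4 W j"
    using V j by (rule bexI)
  moreover have "\<exists>k\<in>{0, 1, 2} \<times> {0, 1} \<times> {0, 1}. run (inv orn_h) orn_v 4 (- W) k"
    using H k by (rule bexI)
  ultimately show False
    unfolding step
    by (simp add: insert_Times_insert bex_Un Sigma_Un_distrib1 inv_orn_h mod_3_simps) argo
qed

text \<open>The dominant coordinate carries more than half of the squared norm, so its total
  variation exceeds \<open>sqrt 288 / sqrt 2 = 12\<close>. That variation is the length of the
  rescaled parameter interval.\<close>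

lemma segment_length_bound:
  assumes "a < b" "\<bar>y\<bar> < \<bar>x\<bar>" "sqrt 288 \<le> segment_length a b (x, y) \<or> sqrt 288 \<le> segment_length a b (y, x)"
  shows "12 < max (x * a) (x * b) - min (x * a) (x * b)"
proof -
  have "sqrt 288 \<le> (b - a) * sqrt (x\<^sup>2 + y\<^sup>2)"
    using assms(1,3) by (auto simp: segment_length_def norm_Pair add.commute)
  then have "(sqrt 288)\<^sup>2 \<le> ((b - a) * sqrt (x\<^sup>2 + y\<^sup>2))\<^sup>2"
    by (intro power_mono) simp_all
  then have "288 \<le> (b - a)\<^sup>2 * (x\<^sup>2 + y\<^sup>2)"
    by (simp add: power_mult_distrib)
  also have "\<dots> < (b - a)\<^sup>2 * (x\<^sup>2 + x\<^sup>2)"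
    using assms(1,2) abs_le_square_iff[of x y] by (intro mult_strict_left_mono) auto
  finally have "144 < (b - a)\<^sup>2 * x\<^sup>2"
    unfolding distrib_left by linarith
  also have "\<dots> = ((b - a) * \<bar>x\<bar>)\<^sup>2"
    by (simp only: power_mult_distrib power2_abs)
  finally have "12\<^sup>2 < ((b - a) * \<bar>x\<bar>)\<^sup>2"
    by simp
  then have "12 < (b - a) * \<bar>x\<bar>"
    by (rule power2_less_imp_less) (use assms(1) in simp)
  also have "\<dots> = max (x * a) (x * b) - min (x * a) (x * b)"
  proof (cases "0 \<le> x")
    case True
    then have "x * a \<le> x * b" using assms(1) by (intro mult_left_mono) simp_all
    then show ?thesis using True by (simp add: algebra_simps)
  next
    case False
    then have "x * b \<le> x * a" using assms(1) by (intro mult_left_mono_neg) simp_all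
    then show ?thesis using False by (simp add: algebra_simps)
  qed
  finally show ?thesis .
qed

lemma slope_eq: "snd u \<noteq> 0 \<Longrightarrow> slope u = ereal (fst u / snd u)"
  by (simp add: slope_def)

lemma slope_eq_zero_denominator: "snd u = 0 \<Longrightarrow> slope u \<in> {0, \<infinity>, -\<infinity>}"
  by (cases "fst u" "0 :: real" rule: linorder_cases)
    (auto simp: slope_def divide_ereal_def zero_ereal_def[symmetric])

theorem proposition3p1:
  fixes H V :: "real \<Rightarrow> (orn_index \<times> real \<times> real) set"
    and a b c d :: real and u w :: "real \<times> real"
  assumes "segment orn_h orn_v a b u H"
    and "segment orn_h orn_v c d w V"
    and "0 < slope w" and "slope w < 1"
    and "slope u < -1"
    and "segment_length a b u \<ge> sqrt 288"
    and "segment_length c d w \<ge> sqrt 288"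
  shows "H ` {a<..<b} \<inter> V ` {c<..<d} \<noteq> {}"
proof
  assume disjoint: "H ` {a<..<b} \<inter> V ` {c<..<d} = {}"
  have "a < b" "c < d" using assms(1,2) unfolding segment_def by blast+
  obtain x y where u: "u = (x, y)" by (cases u)
  obtain x' y' where w: "w = (x', y')" by (cases w)
  \<comment> \<open>A zero denominator would make the slope 0 or infinite.\<close>
  have "y' \<noteq> 0"
    using slope_eq_zero_denominator[of w] assms(3,4) w by auto
  then have \<sigma>: "0 < x' / y'" "x' / y' < 1"
    using slope_eq[of w] assms(3,4) by (auto simp: w)
  then have "\<bar>x'\<bar> < \<bar>y'\<bar>"
    by (auto simp: zero_less_divide_iff divide_less_eq split: if_splits)
  \<comment> \<open>The slope bound for \<open>H\<close> admits negative infinity; this is the case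
    \<open>y = 0\<close>, which gives the normalised value 0.\<close>
  have m: "x \<noteq> 0 \<and> 0 \<le> - y / x \<and> - y / x < 1"
  proof (cases "y = 0")
    case True
    then show ?thesis using assms(5) by (cases "x = 0") (auto simp: u slope_def zero_ereal_def[symmetric])
  next
    case False
    then have "x / y < -1"
      using slope_eq[of u] assms(5) by (simp add: u one_ereal_def)
    then have "0 < y \<and> x < - y \<or> y < 0 \<and> - y < x"
      using False by (auto simp: divide_less_eq split: if_splits)
    then show ?thesis
      by (auto simp: divide_le_0_iff less_divide_eq)
  qed
  then have "- 1 < y / x" "y / x \<le> 0" by auto
  then have "\<bar>y / x\<bar> < 1" by linarith
  then have "\<bar>y\<bar> / \<bar>x\<bar> < 1" by (simp only: abs_divide)
  moreover have "0 < \<bar>x\<bar>" using m by simp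
  ultimately have "\<bar>y\<bar> < 1 * \<bar>x\<bar>" by (simp only: pos_divide_less_eq)
  then have "\<bar>y\<bar> < \<bar>- x\<bar>" by simp
  \<comment> \<open>Time is multiplied by \<open>- x\<close> for \<open>H\<close> and by
    \<open>y'\<close> for \<open>V\<close>, which divides the velocities by these factors. Either
    factor may be negative.\<close>
  define a' b' c' d' where "a' = min (- x * a) (- x * b)" and "b' = max (- x * a) (- x * b)"
    and "c' = min (y' * c) (y' * d)" and "d' = max (y' * c) (y' * d)"
  note defs = a'_def b'_def c'_def d'_def
  have "sqrt 288 \<le> segment_length a b (- x, y)"
    using assms(6) by (simp add: u segment_length_def norm_Pair)
  then have long_H: "12 < b' - a'"
    unfolding defs using segment_length_bound[OF \<open>a < b\<close> \<open>\<bar>y\<bar> < \<bar>- x\<bar>\<close>] by blast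
  have long_V: "12 < d' - c'"
    unfolding defs using segment_length_bound[OF \<open>c < d\<close> \<open>\<bar>x'\<bar> < \<bar>y'\<bar>\<close>] assms(7) w by blast
  interpret disjoint_straight_paths orn_h orn_v "\<lambda>t. V (t / y')" "\<lambda>t. H (t / - x)" a' b' c' d' "x' / y'" "- y / x"
  proof
    show "surj orn_h" "surj orn_v"
      using bij_orn_h bij_orn_v by (simp_all add: bij_is_surj)
    show "straight_path orn_h orn_v c' d' (x' / y', 1) (\<lambda>t. V (t / y'))"
      using straight_path_rescale[OF segment_imp_straight_path[OF assms(2)] \<open>c < d\<close> \<open>y' \<noteq> 0\<close>]
        \<open>y' \<noteq> 0\<close> by (simp add: defs w)
    show "straight_path orn_h orn_v a' b' (-1, - y / x) (\<lambda>t. H (t / - x))"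
      using straight_path_rescale[OF segment_imp_straight_path[OF assms(1)] \<open>a < b\<close>, of "- x"] m
      by (simp add: defs u)
    fix s t assume "c' < s" "s < d'" "a' < t" "t < b'"
    then have "s / y' \<in> {c<..<d}" "t / - x \<in> {a<..<b}"
      using mem_rescaled_interval[OF \<open>c < d\<close> \<open>y' \<noteq> 0\<close>] mem_rescaled_interval[OF \<open>a < b\<close>, of "- x"] m
      by (simp_all add: defs)
    then show "V (s / y') \<noteq> H (t / - x)" using disjoint by blast
  qed (use \<sigma> m in auto)
  \<comment> \<open>Runs with \<open>n = 4\<close> ask for more than \<open>4 + 5 = 9\<close> units
    of time, and more than 12 are available.\<close>
  obtain j where "run orn_v orn_h 4 V_squares j"
    using long_run_V[of 4] long_V by auto
  moreover obtain k where "run (inv orn_h) orn_v 4 H_squares k"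
    using long_run_H[of 4] long_H by auto
  ultimately show False
    using orn_runs_meet V_H_squares_disjoint by blast
qed

end
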